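(* Let $\frac{\sqrt3}{2}<x<1$ and write $x=\cos\frac{\alpha}{2}$ with $\frac{2\pi}{6}>\alpha>0$. Then the image of $\rho'_x=c\circ\rho_x:G(3_1)\to SO^0(1,2)$ is a subgroup of $SO^0(1,2)$ isomorphic to the holonomy of the 2-dimensional hyperbolic cone-manifold $S^2_{\frac{2\pi}{2},\frac{2\pi}{3},\alpha}$.
   Context: $G(3_1)=\langle a,b\mid aba=bab\rangle$ is the trefoil knot group. $H=\left(\frac{-1,1}{\mathbb R}\right)\cong M(2,\mathbb R)$ is the quaternion algebra with basis $1,i,j,ij$, where $i^2=-1$, $j^2=1$, $ij=-ji$; its norm-one group is $U_1=SL(2,\mathbb R)$; $H_0\cong E^{1,2}$ is the space of pure quaternions with the norm as quadratic form (Minkowski space). The homomorphism $c:SL(2,\mathbb R)\to SO^0(1,2)\cong \mathrm{Iso}^+(\mathbb H^2)$ is $c(A)(v)=Av\overline{A}$, where $\overline{A}$ is the quaternion conjugate. For $\frac{\sqrt3}{2}<x<1$ the representation $\rho_x:G(3_1)\to SL(2,\mathbb R)$ is $$\rho_x(a)=x+\sqrt{1-x^2}\,i,\qquad \rho_x(b)=x+\frac{2x^2-1}{2\sqrt{1-x^2}}\,i+\frac12\sqrt{\frac{4x^2-3}{1-x^2}}\,j .$$ The hyperbolic cone-manifold $S^2_{\frac{2\pi}{2},\frac{2\pi}{3},\alpha}$ is the 2-sphere with three cone points of cone angles $\pi$, $\frac{2\pi}{3}$, $\alpha$. It is obtained from the hyperbolic triangle $PQR$ with angle $\frac{2\pi}{3}$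 at $R$ and angles $\frac{\alpha}{2}$ at $P$ and $Q$ by identifying the edge $RP$ with the edge $RQ$ via the rotation about $R$, and folding the edge $PQ$ about its midpoint via the rotation of angle $\pi$. Its holonomy is the subgroup of $\mathrm{Iso}^+(\mathbb H^2)$ generated by the rotations of angle $\alpha$ about $P$ and about $Q$. *)

theory Defs
  imports "HOL-Analysis.Analysis" "HOL-Algebra.Bij" "HOL-Algebra.Generated_Groups"
begin

section \<open>Groups given by generators and relations\<close>

text \<open>A letter \<open>(g, False)\<close> stands for the generator \<open>g\<close>, and \<open>(g, True)\<close> for its formal
  inverse. A relation \<open>u = v\<close> is the pair \<open>(u, v)\<close>.\<close>

type_synonym 'g word = "('g \<times> bool) list"

inductive pres_eq :: "('g word \<times> 'g word) set \<Rightarrow> 'g word \<Rightarrow> 'g word \<Rightarrow> bool"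
  for R :: "('g word \<times> 'g word) set"
where
  rel: "(u, v) \<in> R \<Longrightarrow> pres_eq R u v"
| cancel: "pres_eq R [(g, e), (g, \<not> e)] []"
| refl: "pres_eq R u u"
| sym: "pres_eq R u v \<Longrightarrow> pres_eq R v u"
| trans: "pres_eq R u v \<Longrightarrow> pres_eq R v w \<Longrightarrow> pres_eq R u w"
| append: "pres_eq R u u' \<Longrightarrow> pres_eq R v v' \<Longrightarrow> pres_eq R (u @ v) (u' @ v')"

definition pres_class :: "('g word \<times> 'g word) set \<Rightarrow> 'g word \<Rightarrow> 'g word set"
  where "pres_class R u = {v. pres_eq R u v}"

definition presented_group :: "('g word \<times> 'g word) set \<Rightarrow> 'g word set monoid"
  where "presented_group R =
    \<lparr>carrier = range (pres_class R),
     mult = (\<lambda>X Y. \<Union>u\<in>X. \<Union>v\<in>Y. pres_class R (u @ v)),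
     one = pres_class R []\<rparr>"

fun eval_word :: "('h, 'm) monoid_scheme \<Rightarrow> ('g \<Rightarrow> 'h) \<Rightarrow> 'g word \<Rightarrow> 'h"
where
  "eval_word H f [] = \<one>\<^bsub>H\<^esub>"
| "eval_word H f ((g, e) # w) =
     (if e then inv\<^bsub>H\<^esub> (f g) else f g) \<otimes>\<^bsub>H\<^esub> eval_word H f w"

text \<open>The map on the presented group that extends \<open>f\<close>. It is only meaningful when the values
  of \<open>f\<close> satisfy the relations in \<open>H\<close>, in which case \<open>eval_word H f\<close> is constant on classes.\<close>

definition pres_lift ::
    "('h, 'm) monoid_scheme \<Rightarrow> ('g \<Rightarrow> 'h) \<Rightarrow> 'g word set \<Rightarrow> 'h"
  where "pres_lift H f X = the_elem (eval_word H f ` X)"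

datatype gen = GenA | GenB

definition trefoil_group :: "gen word set monoid"
  where "trefoil_group =
    presented_group
      {([(GenA, False), (GenB, False), (GenA, False)],
        [(GenB, False), (GenA, False), (GenB, False)])}"


section \<open>The quaternion algebra with i^2 = -1, j^2 = 1, ij = -ji\<close>

datatype quat = Quat (q1: real) (qi: real) (qj: real) (qk: real)

lemma quat_eq_iff: "p = q \<longleftrightarrow> q1 p = q1 q \<and> qi p = qi q \<and> qj p = qj q \<and> qk p = qk q"
  by (cases p; cases q) auto

instantiation quat :: real_algebra_1
begin

definition "0 = Quat 0 0 0 0"
definition "1 = Quat 1 0 0 0"
definition "p + q = Quat (q1 p + q1 q) (qi p + qi q) (qj p + qj q) (qk p + qk q)"
definition "p - q = Quat (q1 p - q1 q) (qi p - qi q) (qj p - qj q) (qk p - qk q)"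
definition "- p = Quat (- q1 p) (- qi p) (- qj p) (- qk p)"
definition "r *\<^sub>R p = Quat (r * q1 p) (r * qi p) (r * qj p) (r * qk p)"

text \<open>The product is the bilinear one determined by the multiplication table of
  \<open>1, i, j, ij\<close>, which is confirmed in \<open>quat_table\<close> below.\<close>

definition "p * q = Quat
   (q1 p * q1 q - qi p * qi q + qj p * qj q + qk p * qk q)
   (q1 p * qi q + qi p * q1 q - qj p * qk q + qk p * qj q)
   (q1 p * qj q + qj p * q1 q - qi p * qk q + qk p * qi q)
   (q1 p * qk q + qk p * q1 q + qi p * qj q - qj p * qi q)"

instance
  by standard
    (simp_all add: quat_eq_iff zero_quat_def one_quat_def plus_quat_def minus_quat_def
      uminus_quat_def scaleR_quat_def times_quat_def algebra_simps)

end

definition quat_i :: quat where "quat_i = Quat 0 1 0 0"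
definition quat_j :: quat where "quat_j = Quat 0 0 1 0"

lemma quat_table:
  "quat_i * quat_i = - 1" "quat_j * quat_j = 1" "quat_j * quat_i = - (quat_i * quat_j)"
  by (simp_all add: quat_i_def quat_j_def times_quat_def one_quat_def uminus_quat_def)

lemma quat_basis:
  "q = of_real (q1 q) + qi q *\<^sub>R quat_i + qj q *\<^sub>R quat_j + qk q *\<^sub>R (quat_i * quat_j)"
  by (simp add: quat_eq_iff of_real_def quat_i_def quat_j_def times_quat_def one_quat_def
      plus_quat_def scaleR_quat_def)

definition qconj :: "quat \<Rightarrow> quat"
  where "qconj q = Quat (q1 q) (- qi q) (- qj q) (- qk q)"

definition qnorm :: "quat \<Rightarrow> real"
  where "qnorm q = q1 (q * qconj q)"

lemma qnorm_of_real: "q * qconj q = of_real (qnorm q)"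
  by (simp add: quat_eq_iff of_real_def qnorm_def qconj_def times_quat_def one_quat_def
      scaleR_quat_def)

text \<open>The group of quaternions of norm one; it is isomorphic to \<open>SL(2, R)\<close>.\<close>

definition U1 :: "quat monoid"
  where "U1 = \<lparr>carrier = {q. qnorm q = 1}, mult = (*), one = 1\<rparr>"


section \<open>Minkowski space and the group SO^0(1,2)\<close>

text \<open>Pure quaternions are given by their coordinates with respect to \<open>i, j, ij\<close>.\<close>

definition pure :: "real^3 \<Rightarrow> quat"
  where "pure v = Quat 0 (v$1) (v$2) (v$3)"

definition pure_part :: "quat \<Rightarrow> real^3"
  where "pure_part q = vector [qi q, qj q, qk q]"

definition mink :: "real^3 \<Rightarrow> real^3 \<Rightarrow> real"
  where "mink u v = u$1 * v$1 - u$2 * v$2 - u$3 * v$3"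

lemma mink_eq_qnorm: "mink v v = qnorm (pure v)"
  by (simp add: mink_def qnorm_def pure_def qconj_def times_quat_def)

definition SO12 :: "(real^3^3) set"
  where "SO12 = {A. (\<forall>u v. mink (A *v u) (A *v v) = mink u v) \<and> det A = 1}"

definition SO0_12 :: "(real^3^3) monoid"
  where "SO0_12 =
    \<lparr>carrier = connected_component_set SO12 (mat 1), mult = (**), one = mat 1\<rparr>"

text \<open>The homomorphism \<open>c\<close>, with values written as matrices in the basis \<open>i, j, ij\<close>.\<close>

definition conj_rep :: "quat \<Rightarrow> real^3^3"
  where "conj_rep A = matrix (\<lambda>v. pure_part (A * pure v * qconj A))"

lemma pure_conj_rep: "pure (conj_rep A *v v) = A * pure v * qconj A"
proof -
  have "linear (\<lambda>v. pure_part (A * pure v * qconj A))"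
    by (rule linearI)
      (simp_all add: vec_eq_iff forall_3 pure_part_def pure_def qconj_def times_quat_def
        algebra_simps)
  then show ?thesis
    by (simp add: conj_rep_def matrix_works pure_def pure_part_def qconj_def times_quat_def
        quat_eq_iff algebra_simps)
qed


section \<open>The representations of the trefoil group\<close>

definition rho_gen :: "real \<Rightarrow> gen \<Rightarrow> quat"
  where "rho_gen x g = (case g of
      GenA \<Rightarrow> of_real x + sqrt (1 - x\<^sup>2) *\<^sub>R quat_i
    | GenB \<Rightarrow> of_real x + ((2 * x\<^sup>2 - 1) / (2 * sqrt (1 - x\<^sup>2))) *\<^sub>R quat_i
               + (1 / 2 * sqrt ((4 * x\<^sup>2 - 3) / (1 - x\<^sup>2))) *\<^sub>R quat_j)"

definition rho :: "real \<Rightarrow> gen word set \<Rightarrow> quat"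
  where "rho x = pres_lift U1 (rho_gen x)"

definition rho' :: "real \<Rightarrow> gen word set \<Rightarrow> real^3^3"
  where "rho' x = conj_rep \<circ> rho x"


section \<open>The hyperbolic plane\<close>

text \<open>The hyperboloid model in Minkowski space of signature \<open>(+, -, -)\<close>.\<close>

definition H2 :: "(real^3) set"
  where "H2 = {v. mink v v = 1 \<and> v$1 > 0}"

definition hdist :: "real^3 \<Rightarrow> real^3 \<Rightarrow> real"
  where "hdist u v = arcosh (mink u v)"

text \<open>Positive for counterclockwise triples of points, negative for clockwise triples, zero
  exactly for triples lying on a common hyperbolic line.\<close>

definition horient :: "real^3 \<Rightarrow> real^3 \<Rightarrow> real^3 \<Rightarrow> real"
  where "horient u v w = sgn (det (vector [u, v, w] :: real^3^3))"

text \<open>The group of orientation-preserving isometries of \<open>H2\<close>, under composition.\<close>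

definition Iso_plus :: "(real^3 \<Rightarrow> real^3) monoid"
  where "Iso_plus = BijGroup H2
    \<lparr>carrier := {f \<in> Bij H2.
       (\<forall>u\<in>H2. \<forall>v\<in>H2. hdist (f u) (f v) = hdist u v) \<and>
       (\<forall>u\<in>H2. \<forall>v\<in>H2. \<forall>w\<in>H2. horient (f u) (f v) (f w) = horient u v w)}\<rparr>"

text \<open>The component of \<open>v\<close> in the tangent plane of \<open>H2\<close> at \<open>p\<close>, the orthogonal complement
  of \<open>p\<close>. On this plane the Riemannian metric is \<open>- mink\<close>.\<close>

definition tang :: "real^3 \<Rightarrow> real^3 \<Rightarrow> real^3"
  where "tang p v = v - mink p v *\<^sub>R p"

text \<open>The angle at \<open>p\<close> between the geodesic segments from \<open>p\<close> to \<open>u\<close> and from \<open>p\<close> to \<open>v\<close>.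
  The vector \<open>tang p u\<close> is a positive multiple of the initial velocity of the segment from
  \<open>p\<close> to \<open>u\<close>.\<close>

definition hangle :: "real^3 \<Rightarrow> real^3 \<Rightarrow> real^3 \<Rightarrow> real"
  where "hangle u p v =
    arccos (- mink (tang p u) (tang p v) /
      (sqrt (- mink (tang p u) (tang p u)) * sqrt (- mink (tang p v) (tang p v))))"

text \<open>The counterclockwise quarter turn of the tangent plane at \<open>p\<close>: for a pure quaternion
  \<open>t\<close> orthogonal to \<open>p\<close> the product \<open>p t\<close> is again pure and orthogonal to \<open>p\<close>.\<close>

definition qturn :: "real^3 \<Rightarrow> real^3 \<Rightarrow> real^3"
  where "qturn p t = pure_part (pure p * pure t)"

lemma qturn:
  assumes "p \<in> H2" "mink p t = 0"
  shows "pure (qturn p t) = pure p * pure t"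
    and "mink p (qturn p t) = 0"
    and "mink t (qturn p t) = 0"
    and "mink (qturn p t) (qturn p t) = mink t t"
    and "det (vector [p, t, qturn p t] :: real^3^3) = - mink t t"
proof -
  have p: "p$1 * p$1 - p$2 * p$2 - p$3 * p$3 = 1"
    and t: "p$1 * t$1 - p$2 * t$2 - p$3 * t$3 = 0"
    using assms by (auto simp: H2_def mink_def)
  show "pure (qturn p t) = pure p * pure t"
    using t by (simp add: qturn_def pure_def pure_part_def times_quat_def)
  show "mink p (qturn p t) = 0" "mink t (qturn p t) = 0"
    by (simp_all add: mink_def qturn_def pure_def pure_part_def times_quat_def algebra_simps)
  show "mink (qturn p t) (qturn p t) = mink t t"
    using p t unfolding mink_def qturn_def pure_def pure_part_def times_quat_def
    by simp algebra
  show "det (vector [p, t, qturn p t] :: real^3^3) = - mink t t"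
    using p t unfolding mink_def qturn_def pure_def pure_part_def times_quat_def det_3
    by simp algebra
qed

text \<open>The rotation of \<open>H2\<close> about \<open>p\<close> through the (counterclockwise) angle \<open>\<theta>\<close>: it fixes
  \<open>p\<close> and rotates the tangent plane at \<open>p\<close> by \<open>\<theta>\<close>.\<close>

definition hrot :: "real^3 \<Rightarrow> real \<Rightarrow> real^3 \<Rightarrow> real^3"
  where "hrot p \<theta> = (\<lambda>v\<in>H2.
    mink p v *\<^sub>R p + cos \<theta> *\<^sub>R tang p v + sin \<theta> *\<^sub>R qturn p (tang p v))"


section \<open>The cone-manifold with cone angles 2 pi/2, 2 pi/3, alpha\<close>

text \<open>The triangle from which the cone-manifold is glued: \<open>R P\<close> is identified with \<open>R Q\<close> by
  the rotation about \<open>R\<close>, which gives the cone point of angle \<open>2\<pi>/3\<close>; \<open>P Q\<close> is folded about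
  its midpoint, which gives the cone point of angle \<open>\<pi>\<close>; and \<open>P\<close>, \<open>Q\<close> become one cone point,
  of angle \<open>\<alpha>/2 + \<alpha>/2\<close>.\<close>

definition cone_triangle :: "real \<Rightarrow> real^3 \<Rightarrow> real^3 \<Rightarrow> real^3 \<Rightarrow> bool"
  where "cone_triangle \<alpha> P Q R \<longleftrightarrow>
    P \<in> H2 \<and> Q \<in> H2 \<and> R \<in> H2 \<and> distinct [P, Q, R] \<and>
    hangle P R Q = 2 * pi / 3 \<and> hangle R P Q = \<alpha> / 2 \<and> hangle R Q P = \<alpha> / 2"

text \<open>The holonomy group of the cone-manifold glued from the triangle \<open>P Q R\<close>.\<close>

definition cone_holonomy :: "real \<Rightarrow> real^3 \<Rightarrow> real^3 \<Rightarrow> (real^3 \<Rightarrow> real^3) monoid"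
  where "cone_holonomy \<alpha> P Q =
    Iso_plus\<lparr>carrier := generate Iso_plus {hrot P \<alpha>, hrot Q \<alpha>}\<rparr>"

end

theory Submission
  imports Defs
begin

text \<open>Conjugation by \<open>cos (\<alpha>/2) + sin (\<alpha>/2) p\<close> is the rotation by \<open>\<alpha>\<close> about the point
  \<open>p\<close> of the hyperboloid, and \<open>\<rho>(a)\<close>, \<open>\<rho>(b)\<close> have this form for two points \<open>P\<^sub>0\<close>, \<open>Q\<^sub>0\<close> with
  \<open>cosh d(P\<^sub>0, Q\<^sub>0) = (2x\<^sup>2 - 1) / (2(1 - x\<^sup>2))\<close>. So the image of \<open>\<rho>'\<close> is generated by the
  rotations by \<open>\<alpha>\<close> about \<open>P\<^sub>0\<close> and \<open>Q\<^sub>0\<close>. Hyperbolic trigonometry shows that the vertices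
  \<open>P\<close>, \<open>Q\<close> of any triangle with angles \<open>2\<pi>/3\<close>, \<open>\<alpha>/2\<close>, \<open>\<alpha>/2\<close> are at the same distance, hence
  some isometry \<open>g\<close> takes \<open>P\<^sub>0\<close>, \<open>Q\<^sub>0\<close> to \<open>P\<close>, \<open>Q\<close>, and conjugation by \<open>g\<close> takes the one
  rotation group to the other.\<close>

section \<open>Maps out of a presented group\<close>

lemma eval_word_closed:
  assumes "group H" "\<And>g. f g \<in> carrier H"
  shows "eval_word H f w \<in> carrier H"
proof -
  interpret group H by fact
  show ?thesis
  proof (induction w)
    case (Cons p w)
    then show ?case using assms(2) by (cases p) auto
  qed simp
qed

lemma eval_word_append:
  assumes "group H" "\<And>g. f g \<in> carrier H"
  shows "eval_word H f (u @ v) = eval_word H f u \<otimes>\<^bsub>H\<^esub> eval_word H f v"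
proof -
  interpret group H by fact
  show ?thesis
  proof (induction u)
    case Nil
    then show ?case using eval_word_closed[where f=f, OF assms] by simp
  next
    case (Cons p u)
    then show ?case
      using eval_word_closed[where f=f, OF assms] assms(2) by (cases p) (simp add: m_assoc)
  qed
qed

text \<open>Every rule of \<open>pres_eq\<close> except \<open>rel\<close> yields an identity valid
  in any group, and \<open>rel\<close> is covered by the third assumption. Hence evaluation descends
  to classes.\<close>

lemma eval_word_pres_eq:
  assumes "group H" "\<And>g. f g \<in> carrier H"
    and "\<And>u v. (u, v) \<in> R \<Longrightarrow> eval_word H f u = eval_word H f v"
    and "pres_eq R u v"
  shows "eval_word H f u = eval_word H f v"
proof -
  interpret group H by fact
  show ?thesis
    using assms(4)
  proof induction
    case (cancel g e)
    then show ?case using assms(2)[of g] by simp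
  next
    case (append u u' v v')
    then show ?case by (simp add: eval_word_append[OF assms(1,2)])
  qed (auto simp: assms(3))
qed

lemma pres_lift_class:
  assumes "group H" "\<And>g. f g \<in> carrier H"
    and "\<And>u v. (u, v) \<in> R \<Longrightarrow> eval_word H f u = eval_word H f v"
  shows "pres_lift H f (pres_class R u) = eval_word H f u"
proof -
  have "eval_word H f ` pres_class R u = (\<lambda>_. eval_word H f u) ` pres_class R u"
    by (intro image_cong refl eval_word_pres_eq[OF assms, symmetric]) (simp_all add: pres_class_def)
  also have "\<dots> = {eval_word H f u}"
    by (rule image_constant[of u]) (simp add: pres_class_def pres_eq.refl)
  finally have "eval_word H f ` pres_class R u = {eval_word H f u}" .
  then show ?thesis by (simp add: pres_lift_def)
qed

text \<open>The product is a union over all pairs of representatives. Since \<open>pres_eq\<close>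
  is a congruence, every class in that union is the same one.\<close>

lemma pres_class_append:
  "pres_class R u \<otimes>\<^bsub>presented_group R\<^esub> pres_class R v = pres_class R (u @ v)"
proof -
  have "pres_class R (u' @ v') = pres_class R (u @ v)" if "pres_eq R u u'" "pres_eq R v v'" for u' v'
    using pres_eq.append[OF that] by (auto simp: pres_class_def intro: pres_eq.trans pres_eq.sym)
  then have "(\<Union>u'\<in>pres_class R u. \<Union>v'\<in>pres_class R v. pres_class R (u' @ v'))
      = (\<Union>u'\<in>pres_class R u. \<Union>v'\<in>pres_class R v. pres_class R (u @ v))"
    by (intro SUP_cong refl) (simp_all add: pres_class_def)
  moreover have "u \<in> pres_class R u" "v \<in> pres_class R v"
    by (simp_all add: pres_class_def pres_eq.refl)
  ultimately show ?thesis
    by (auto simp: presented_group_def)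
qed

lemma pres_lift_hom:
  assumes "group H" "\<And>g. f g \<in> carrier H"
    and "\<And>u v. (u, v) \<in> R \<Longrightarrow> eval_word H f u = eval_word H f v"
  shows "pres_lift H f \<in> hom (presented_group R) H"
proof (rule homI)
  fix X assume "X \<in> carrier (presented_group R)"
  then show "pres_lift H f X \<in> carrier H"
    using pres_lift_class[of H f R] assms eval_word_closed[of H f]
    by (auto simp: presented_group_def)
next
  fix X Y assume "X \<in> carrier (presented_group R)" "Y \<in> carrier (presented_group R)"
  then obtain u v where "X = pres_class R u" "Y = pres_class R v"
    by (auto simp: presented_group_def)
  then show "pres_lift H f (X \<otimes>\<^bsub>presented_group R\<^esub> Y) = pres_lift H f X \<otimes>\<^bsub>H\<^esub> pres_lift H f Y"
    using pres_lift_class[of H f R] assms eval_word_append[of H f]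
    by (simp add: pres_class_append)
qed

lemma range_eval_word:
  assumes "group H" "\<And>g. f g \<in> carrier H"
  shows "range (eval_word H f) = generate H (range f)"
proof
  interpret group H by fact
  have "eval_word H f w \<in> generate H (range f)" for w
  proof (induction w)
    case (Cons p w)
    then show ?case
      by (cases p) (auto intro: generate.eng generate.incl generate.inv)
  qed (simp add: generate.one)
  then show "range (eval_word H f) \<subseteq> generate H (range f)" by auto
  show "generate H (range f) \<subseteq> range (eval_word H f)"
  proof
    fix h assume "h \<in> generate H (range f)"
    then show "h \<in> range (eval_word H f)"
    proof induction
      case one
      show ?case by (rule range_eqI[of _ _ "[]"]) simp
    next
      case (incl h)
      then obtain g where "h = f g" by auto
      then have "h = eval_word H f [(g, False)]" using assms(2) by simp
      then show ?case by blast
    next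
      case (inv h)
      then obtain g where "h = f g" by auto
      then have "inv\<^bsub>H\<^esub> h = eval_word H f [(g, True)]" using assms(2) by simp
      then show ?case by blast
    next
      case (eng h1 h2)
      then obtain u v where "h1 = eval_word H f u" "h2 = eval_word H f v" by auto
      then show ?case using eval_word_append[of H f u v] assms by (metis rangeI)
    qed
  qed
qed

lemma pres_lift_image:
  assumes "group H" "\<And>g. f g \<in> carrier H"
    and "\<And>u v. (u, v) \<in> R \<Longrightarrow> eval_word H f u = eval_word H f v"
  shows "pres_lift H f ` carrier (presented_group R) = generate H (range f)"
  using pres_lift_class[of H f R] assms
  by (simp add: presented_group_def image_image flip: range_eval_word)

section \<open>Norm-one quaternions\<close>

lemma qnorm_eq: "qnorm q = (q1 q)\<^sup>2 + (qi q)\<^sup>2 - (qj q)\<^sup>2 - (qk q)\<^sup>2"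
  by (simp add: qnorm_def qconj_def times_quat_def power2_eq_square)

lemma qconj_mult: "qconj (p * q) = qconj q * qconj p"
  by (simp add: qconj_def times_quat_def algebra_simps)

lemma qconj_of_norm_one:
  assumes "qnorm q = 1"
  shows "q * qconj q = 1" "qconj q * q = 1" "qnorm (qconj q) = 1"
  using assms
  by (simp_all add: qnorm_eq qconj_def times_quat_def one_quat_def power2_eq_square algebra_simps)

lemma qnorm_mult: "qnorm (p * q) = qnorm p * qnorm q"
  by (simp add: qnorm_eq times_quat_def power2_eq_square algebra_simps)

lemma group_U1: "group U1"
proof (rule groupI)
  fix q assume "q \<in> carrier U1"
  then show "\<exists>p\<in>carrier U1. p \<otimes>\<^bsub>U1\<^esub> q = \<one>\<^bsub>U1\<^esub>"
    by (intro bexI[of _ "qconj q"]) (auto simp: U1_def qconj_of_norm_one)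
next
  show "\<one>\<^bsub>U1\<^esub> \<in> carrier U1"
    by (simp add: U1_def qnorm_eq one_quat_def)
qed (auto simp: U1_def qnorm_mult mult.assoc)

section \<open>The Lorentz group and isometries of the hyperbolic plane\<close>

lemma mat3_mult_vec:
  fixes A :: "real^3^3"
  shows "(A *v v) $ i = A$i$1 * v$1 + A$i$2 * v$2 + A$i$3 * v$3"
  by (simp add: matrix_vector_mult_def sum_3)

lemma vec3_eqI: "u = v" if "u$1 = v$1" "u$2 = v$2" "u$3 = v$3" for u v :: "real^3"
  using that by (simp add: vec_eq_iff forall_3)

lemma mink_add: "mink (u + v) w = mink u w + mink v w" "mink w (u + v) = mink w u + mink w v"
  and mink_diff: "mink (u - v) w = mink u w - mink v w" "mink w (u - v) = mink w u - mink w v"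
  and mink_scaleR: "mink (c *\<^sub>R u) v = c * mink u v" "mink u (c *\<^sub>R v) = c * mink u v"
  by (simp_all add: mink_def algebra_simps)

lemma mink_commute: "mink u v = mink v u"
  by (simp add: mink_def mult.commute)

lemma mink_nondegenerate:
  assumes "\<And>w. mink u w = mink v w"
  shows "u = v"
  using assms[of "axis 1 1"] assms[of "axis 2 1"] assms[of "axis 3 1"]
  by (intro vec3_eqI) (simp_all add: mink_def axis_def)

text \<open>Reversed Cauchy-Schwarz inequality: \<open>(u$1 * v$1)^2\<close> exceeds
  \<open>d^2\<close> by the sum of squares \<open>e\<close>, which vanishes only if the two points
  agree.\<close>

lemma mink_ge_1:
  assumes "u \<in> H2" "v \<in> H2"
  shows "1 \<le> mink u v" and "mink u v = 1 \<longleftrightarrow> u = v"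
proof -
  have u: "(u$1)\<^sup>2 = 1 + (u$2)\<^sup>2 + (u$3)\<^sup>2" "u$1 > 0" and v: "(v$1)\<^sup>2 = 1 + (v$2)\<^sup>2 + (v$3)\<^sup>2" "v$1 > 0"
    using assms by (auto simp: H2_def mink_def power2_eq_square)
  define d where "d = 1 + u$2 * v$2 + u$3 * v$3"
  define e where "e = (u$2 - v$2)\<^sup>2 + (u$3 - v$3)\<^sup>2 + (u$2 * v$3 - u$3 * v$2)\<^sup>2"
  have *: "(u$1 * v$1)\<^sup>2 = d\<^sup>2 + e"
    unfolding power_mult_distrib u v d_def e_def by (simp add: power2_eq_square algebra_simps)
  have "0 \<le> e" by (simp add: e_def)
  with * have "d\<^sup>2 \<le> (u$1 * v$1)\<^sup>2" by simp
  then have "d \<le> u$1 * v$1"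
    by (rule power2_le_imp_le) (use u v in simp)
  then show "1 \<le> mink u v" by (simp add: mink_def d_def)
  show "mink u v = 1 \<longleftrightarrow> u = v"
  proof
    assume "mink u v = 1"
    then have "u$1 * v$1 = d" by (simp add: mink_def d_def)
    with * have "e = 0" by simp
    then have "u$2 = v$2" "u$3 = v$3"
      unfolding e_def by (smt (verit) power2_eq_iff_nonneg zero_le_power2 zero_eq_power2)+
    moreover from this have "u$1 = v$1"
      using u v by (smt (verit) power2_eq_iff_nonneg)
    ultimately show "u = v" by (intro vec3_eqI)
  qed (use assms in \<open>simp add: H2_def\<close>)
qed

text \<open>If \<open>v\<close> lay on the other sheet, \<open>- v\<close> would pair with
  \<open>u\<close> to at least 1, against the sign of \<open>mink v u\<close>.\<close>

lemma H2_I: "v \<in> H2" if "mink v v = 1" "0 \<le> mink v u" "u \<in> H2"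
proof -
  have v: "(v$1)\<^sup>2 = 1 + (v$2)\<^sup>2 + (v$3)\<^sup>2"
    using that by (simp add: mink_def power2_eq_square)
  have "v$1 > 0"
  proof (rule ccontr)
    assume "\<not> v$1 > 0"
    moreover have "v$1 \<noteq> 0" using v by (smt (verit) zero_le_power2 power_zero_numeral)
    ultimately have "- v \<in> H2" using that by (simp add: H2_def mink_def)
    from mink_ge_1(1)[OF this \<open>u \<in> H2\<close>] that show False by (simp add: mink_def)
  qed
  then show ?thesis using that by (simp add: H2_def)
qed

text \<open>The quaternion \<open>i\<close> as a point of the hyperboloid, the centre of the
  rotation given by the first generator.\<close>

definition pole :: "real^3" where "pole = axis 1 1"

lemma pole_H2: "pole \<in> H2"
  by (simp add: pole_def H2_def mink_def axis_def)

lemma pole_nth: "pole $ 1 = 1" "pole $ 2 = 0" "pole $ 3 = 0"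
  by (simp_all add: pole_def axis_def)

lemma mink_pole: "mink pole v = v$1"
  by (simp add: pole_nth mink_def)

section \<open>The Lorentz group and its identity component\<close>

lemma SO12_mult: "A ** B \<in> SO12" if "A \<in> SO12" "B \<in> SO12"
  using that by (simp add: SO12_def det_mul flip: matrix_vector_mul_assoc)

lemma SO12_one: "mat 1 \<in> SO12"
  by (simp add: SO12_def)

lemma mink_SO12: "A \<in> SO12 \<Longrightarrow> mink (A *v u) (A *v v) = mink u v"
  by (simp add: SO12_def)

lemma SO12_inverse:
  assumes "A \<in> SO12"
  obtains B where "B \<in> SO12" "A ** B = mat 1" "B ** A = mat 1"
proof -
  have "invertible A" using assms by (simp add: SO12_def invertible_det_nz)
  then obtain B where B: "A ** B = mat 1" "B ** A = mat 1" by (auto simp: invertible_def)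
  have "det A * det B = 1" using B by (metis det_I det_mul)
  then have "det B = 1" using assms by (simp add: SO12_def)
  moreover have "mink (B *v u) (B *v v) = mink u v" for u v
    using mink_SO12[OF assms, of "B *v u" "B *v v"] B by (simp add: matrix_vector_mul_assoc)
  ultimately have "B \<in> SO12" by (simp add: SO12_def)
  then show ?thesis using B that by blast
qed

lemma SO0_12_subset: "carrier SO0_12 \<subseteq> SO12"
  by (simp add: SO0_12_def connected_component_subset)

text \<open>Left translation by \<open>A\<close> is continuous, so it carries the identity component
  to a connected set through \<open>A\<close>.\<close>

lemma SO12_mult_component:
  assumes "A \<in> SO12"
  shows "(**) A ` carrier SO0_12 \<subseteq> connected_component_set SO12 A"
proof (rule connected_component_maximal)
  show "A \<in> (**) A ` carrier SO0_12"
    by (rule image_eqI[of _ _ "mat 1"]) (simp_all add: SO0_12_def SO12_one)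
  have "continuous_on UNIV ((**) A)"
    by (simp add: matrix_matrix_mult_def[abs_def]) (intro continuous_intros)
  then show "connected ((**) A ` carrier SO0_12)"
    by (rule connected_continuous_image[OF continuous_on_subset])
      (simp_all add: SO0_12_def)
  show "(**) A ` carrier SO0_12 \<subseteq> SO12"
    using SO0_12_subset assms by (auto intro: SO12_mult)
qed

lemma group_SO0_12: "group SO0_12"
proof (rule groupI)
  fix A B assume A: "A \<in> carrier SO0_12" and B: "B \<in> carrier SO0_12"
  then have "connected_component_set SO12 A = carrier SO0_12"
    by (simp add: SO0_12_def connected_component_eq)
  then show "A \<otimes>\<^bsub>SO0_12\<^esub> B \<in> carrier SO0_12"
    using SO12_mult_component[of A] A B SO0_12_subset
    by (auto simp: SO0_12_def)
next
  fix A assume A: "A \<in> carrier SO0_12"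
  then obtain B where B: "B \<in> SO12" "B ** A = mat 1"
    using SO12_inverse[of A] SO0_12_subset by blast
  \<comment> \<open>Translating the identity component by \<open>B\<close> gives a connected set
    that contains \<open>B\<close> and also \<open>B ** A\<close>, the identity.\<close>
  have "mat 1 \<in> connected_component_set SO12 B"
    using SO12_mult_component[OF B(1)] A B(2) by force
  then have "B \<in> carrier SO0_12"
    by (simp add: SO0_12_def connected_component_sym)
  with B show "\<exists>B\<in>carrier SO0_12. B \<otimes>\<^bsub>SO0_12\<^esub> A = \<one>\<^bsub>SO0_12\<^esub>"
    by (auto simp: SO0_12_def)
qed (simp_all add: SO0_12_def SO12_one matrix_mul_assoc)

lemma SO12_H2:
  assumes "A \<in> SO12" "A *v u \<in> H2" "u \<in> H2" "v \<in> H2"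
  shows "A *v v \<in> H2"
proof (rule H2_I)
  show "mink (A *v v) (A *v v) = 1"
    using assms by (simp add: mink_SO12 H2_def)
  show "0 \<le> mink (A *v v) (A *v u)"
    using assms mink_ge_1(1)[of v u] by (simp add: mink_SO12)
qed fact

text \<open>The entry \<open>B$1$1\<close> is the first coordinate of \<open>B *v pole\<close>, a
  vector of norm one, so it never vanishes on \<open>SO12\<close>. It is 1 at the identity, hence
  positive on the component, and \<open>pole\<close> stays on its sheet.\<close>

lemma SO0_12_H2:
  assumes "A \<in> carrier SO0_12" "v \<in> H2"
  shows "A *v v \<in> H2"
proof -
  let ?f = "\<lambda>B::real^3^3. B$1$1"
  have nz: "?f B \<noteq> 0" if "B \<in> SO12" for B
  proof
    assume "?f B = 0"
    then have "(B *v pole)$1 = 0" by (simp add: mat3_mult_vec pole_nth)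
    moreover have "mink (B *v pole) (B *v pole) = 1"
      using pole_H2 that by (simp add: mink_SO12 H2_def)
    ultimately show False unfolding mink_def by (smt (verit) mult_eq_0_iff zero_le_square)
  qed
  have "connected (?f ` carrier SO0_12)"
    by (intro connected_continuous_image continuous_intros) (simp add: SO0_12_def)
  then have int: "is_interval (?f ` carrier SO0_12)" by (simp add: is_interval_connected_1)
  have one: "1 \<in> ?f ` carrier SO0_12"
    by (rule image_eqI[of _ _ "mat 1"]) (simp_all add: SO0_12_def SO12_one, simp add: mat_def)
  have "0 < ?f A"
  proof (rule ccontr)
    assume "\<not> 0 < ?f A"
    then have "0 \<in> ?f ` carrier SO0_12"
      by (intro mem_is_interval_1_I[OF int imageI[OF assms(1)] one]) simp_all
    then obtain B where "0 = ?f B" "B \<in> carrier SO0_12" by (rule imageE)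
    then show False using nz[of B] subsetD[OF SO0_12_subset] by simp
  qed
  moreover have "A \<in> SO12" using subsetD[OF SO0_12_subset assms(1)] .
  ultimately have "A *v pole \<in> H2"
    using pole_H2 by (simp add: H2_def mink_SO12 mat3_mult_vec pole_nth)
  from SO12_H2[OF \<open>A \<in> SO12\<close> this pole_H2 assms(2)] show ?thesis .
qed

section \<open>Orientation-preserving isometries of the hyperbolic plane\<close>

lemma subgroup_Iso_plus: "subgroup (carrier Iso_plus) (BijGroup H2)"
proof (rule group.subgroupI[OF group_BijGroup])
  show "carrier Iso_plus \<subseteq> carrier (BijGroup H2)"
    by (auto simp: Iso_plus_def BijGroup_def)
  have "(\<lambda>v\<in>H2. v) \<in> carrier Iso_plus"
    by (simp add: Iso_plus_def id_Bij)
  then show "carrier Iso_plus \<noteq> {}" by blast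
next
  fix f assume f: "f \<in> carrier Iso_plus"
  then have B: "f \<in> Bij H2" by (simp add: Iso_plus_def)
  have inv: "f (inv_into H2 f u) = u" "inv_into H2 f u \<in> H2" if "u \<in> H2" for u
    using B that Bij_inv_into_mem[OF B] by (auto simp: Bij_def bij_betw_def f_inv_into_f)
  have "hdist (f u) (f v) = hdist u v" "horient (f u) (f v) (f w) = horient u v w"
    if "u \<in> H2" "v \<in> H2" "w \<in> H2" for u v w
    using f that by (simp_all add: Iso_plus_def)
  \<comment> \<open>The invariance under \<open>f\<close> is read at preimages, which turns it into
    invariance under the inverse.\<close>
  note this[of "inv_into H2 f _" "inv_into H2 f _" "inv_into H2 f _", OF inv(2) inv(2) inv(2)]
  then have "hdist (inv_into H2 f u) (inv_into H2 f v) = hdist u v"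
    "horient (inv_into H2 f u) (inv_into H2 f v) (inv_into H2 f w) = horient u v w"
    if "u \<in> H2" "v \<in> H2" "w \<in> H2" for u v w
    using that by (metis inv(1))+
  then show "inv\<^bsub>BijGroup H2\<^esub> f \<in> carrier Iso_plus"
    using restrict_inv_into_Bij[OF B]
    by (simp add: inv_BijGroup[OF B] Iso_plus_def)
next
  fix f g assume "f \<in> carrier Iso_plus" "g \<in> carrier Iso_plus"
  then show "f \<otimes>\<^bsub>BijGroup H2\<^esub> g \<in> carrier Iso_plus"
    by (auto simp: Iso_plus_def BijGroup_def compose_Bij compose_eq Bij_imp_funcset[THEN funcset_mem])
qed

lemma group_Iso_plus: "group Iso_plus"
proof -
  have "Iso_plus = BijGroup H2 \<lparr>carrier := carrier Iso_plus\<rparr>"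
    by (simp add: Iso_plus_def)
  then show ?thesis
    using subgroup.subgroup_is_group[OF subgroup_Iso_plus group_BijGroup] by simp
qed

lemma det_vector_transform:
  fixes A :: "real^3^3"
  shows "det (vector [A *v u, A *v v, A *v w] :: real^3^3) = det A * det (vector [u, v, w] :: real^3^3)"
  by (simp add: det_3 mat3_mult_vec) algebra

lemma restrict_SO12_Iso_plus:
  assumes "A \<in> SO12" "\<And>v. v \<in> H2 \<Longrightarrow> A *v v \<in> H2"
  shows "restrict ((*v) A) H2 \<in> carrier Iso_plus"
proof -
  obtain B where B: "B \<in> SO12" "A ** B = mat 1" "B ** A = mat 1"
    using SO12_inverse[OF assms(1)] .
  have BA: "B *v (A *v v) = v" "A *v (B *v v) = v" for v
    by (simp_all add: matrix_vector_mul_assoc B)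
  \<comment> \<open>\<open>B\<close> sends the point \<open>A *v pole\<close> of the sheet back to
    \<open>pole\<close>, so it preserves the sheet by \<open>SO12_H2\<close>.\<close>
  have "B *v v \<in> H2" if "v \<in> H2" for v
    using SO12_H2[OF B(1), of "A *v pole" v] that assms(2) pole_H2 by (simp add: BA)
  then have "bij_betw (restrict ((*v) A) H2) H2 H2"
    using assms(2) by (intro bij_betw_byWitness[of _ "(*v) B"]) (auto simp: BA)
  moreover have "det A = 1" using assms(1) by (simp add: SO12_def)
  ultimately show ?thesis
    using assms(1)
    by (simp add: Iso_plus_def Bij_def hdist_def horient_def mink_SO12 det_vector_transform)
qed

section \<open>The conjugation homomorphism and rotations\<close>

lemma conj_rep_mult: "conj_rep (p * q) = conj_rep p ** conj_rep q"
proof -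
  have "conj_rep (p * q) *v v = (conj_rep p ** conj_rep q) *v v" for v
  proof -
    have "pure (conj_rep (p * q) *v v) = pure ((conj_rep p ** conj_rep q) *v v)"
      by (simp add: pure_conj_rep qconj_mult mult.assoc flip: matrix_vector_mul_assoc)
    then show ?thesis by (intro vec3_eqI) (simp_all add: pure_def)
  qed
  then show ?thesis by (simp add: matrix_eq)
qed

lemma conj_rep_vec:
  "conj_rep q *v v = pure_part (q * pure v * qconj q)"
  by (simp add: pure_part_def vec_eq_iff forall_3 flip: pure_conj_rep) (simp add: pure_def)

text \<open>With the matrix explicit, the determinant, the invariance of the form and the continuity
  of \<open>conj_rep\<close> become questions about polynomials in the four coordinates.\<close>

lemma conj_rep_entries:
  "conj_rep q = vector [
    vector [(q1 q)\<^sup>2 + (qi q)\<^sup>2 + (qj q)\<^sup>2 + (qk q)\<^sup>2,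
      2 * (q1 q * qk q - qi q * qj q), - 2 * (q1 q * qj q + qi q * qk q)],
    vector [2 * (q1 q * qk q + qi q * qj q),
      (q1 q)\<^sup>2 - (qi q)\<^sup>2 - (qj q)\<^sup>2 + (qk q)\<^sup>2, - 2 * (q1 q * qi q + qj q * qk q)],
    vector [2 * (qi q * qk q - q1 q * qj q), 2 * (q1 q * qi q - qj q * qk q),
      (q1 q)\<^sup>2 - (qi q)\<^sup>2 + (qj q)\<^sup>2 - (qk q)\<^sup>2]]"
proof -
  have "conj_rep q $ i $ j = (conj_rep q *v axis j 1) $ i" for i j
    by (simp add: matrix_vector_mul_component inner_axis)
  then show ?thesis
    by (simp add: vec_eq_iff forall_3 conj_rep_vec pure_part_def pure_def qconj_def times_quat_def
        axis_def power2_eq_square algebra_simps)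
qed

lemma det_conj_rep: "det (conj_rep q) = qnorm q ^ 3"
  by (simp add: conj_rep_entries det_3 qnorm_eq) algebra

lemma conj_rep_SO12:
  assumes "qnorm q = 1"
  shows "conj_rep q \<in> SO12"
proof -
  have "mink (conj_rep q *v u) (conj_rep q *v v) = qnorm q ^ 2 * mink u v" for u v
    by (simp add: conj_rep_entries mat3_mult_vec mink_def qnorm_eq) algebra
  then show ?thesis using assms by (simp add: SO12_def det_conj_rep)
qed

text \<open>The norm-one quaternions are a product of a circle and a plane, hence connected.\<close>

lemma conj_rep_SO0_12:
  assumes "qnorm q = 1"
  shows "conj_rep q \<in> carrier SO0_12"
proof -
  define h :: "real \<times> real \<times> real \<Rightarrow> quat" where "h = (\<lambda>(t, y, z).
    Quat (sqrt (1 + y\<^sup>2 + z\<^sup>2) * cos t) (sqrt (1 + y\<^sup>2 + z\<^sup>2) * sin t) y z)"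
  have h: "qnorm (h p) = 1" for p
  proof -
    obtain t y z where p: "p = (t, y, z)" by (cases p)
    have "qnorm (h p) = (1 + y\<^sup>2 + z\<^sup>2) * ((cos t)\<^sup>2 + (sin t)\<^sup>2) - y\<^sup>2 - z\<^sup>2"
      by (simp add: p h_def qnorm_eq power_mult_distrib add_nonneg_nonneg del: sin_cos_squared_add sin_cos_squared_add2)
        (simp only: distrib_left)
    then show ?thesis by simp
  qed
  have one: "conj_rep (h 0) = mat 1"
    by (simp add: h_def zero_prod_def conj_rep_entries vec_eq_iff forall_3 mat_def)
  \<comment> \<open>Norm one says that \<open>r\<close> is the Euclidean length of
    \<open>(q1 q, qi q)\<close>, so \<open>t\<close> is the polar angle of that pair.\<close>
  obtain t where "h (t, qj q, qk q) = q"
  proof -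
    define r where "r = sqrt (1 + (qj q)\<^sup>2 + (qk q)\<^sup>2)"
    have r: "r > 0" unfolding r_def by (intro real_sqrt_gt_zero) (simp add: add_pos_nonneg)
    have "r\<^sup>2 = (q1 q)\<^sup>2 + (qi q)\<^sup>2"
      using assms by (simp add: r_def qnorm_eq add_nonneg_nonneg)
    then have "(q1 q / r)\<^sup>2 + (qi q / r)\<^sup>2 = r\<^sup>2 / r\<^sup>2"
      by (simp add: power_divide flip: add_divide_distrib)
    then have "(q1 q / r)\<^sup>2 + (qi q / r)\<^sup>2 = 1"
      using r by simp
    then obtain t where "q1 q / r = cos t" "qi q / r = sin t"
      by (metis sincos_total_2pi)
    then have "h (t, qj q, qk q) = q"
      using r by (simp add: h_def quat_eq_iff flip: r_def) (metis nonzero_mult_div_cancel_left order_less_irrefl times_divide_eq_right)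
    then show ?thesis by (rule that)
  qed
  then have q: "conj_rep q \<in> range (conj_rep \<circ> h)" by (metis comp_apply rangeI)
  have "continuous_on UNIV (\<lambda>p. (conj_rep \<circ> h) p $ i $ j)" for i j
    using exhaust_3[of i] exhaust_3[of j]
    by (elim disjE; simp add: conj_rep_entries h_def case_prod_beta; intro continuous_intros)
  then have "continuous_on UNIV (conj_rep \<circ> h)"
    using continuous_on_vec_lambda[of UNIV "\<lambda>i p. \<chi> j. (conj_rep \<circ> h) p $ i $ j"]
      continuous_on_vec_lambda[of UNIV "\<lambda>j p. (conj_rep \<circ> h) p $ _ $ j"]
    by simp
  then have "connected (range (conj_rep \<circ> h))"
    by (intro connected_continuous_image connected_UNIV)
  moreover have "range (conj_rep \<circ> h) \<subseteq> SO12" using h by (auto intro: conj_rep_SO12)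
  moreover have "mat 1 \<in> range (conj_rep \<circ> h)" by (metis one comp_apply rangeI)
  ultimately have "range (conj_rep \<circ> h) \<subseteq> connected_component_set SO12 (mat 1)"
    by (rule connected_component_maximal[rotated])
  with q show ?thesis by (auto simp: SO0_12_def)
qed

lemma conj_rep_hom: "conj_rep \<in> hom U1 SO0_12"
  by (rule homI) (simp_all add: U1_def conj_rep_SO0_12, simp add: SO0_12_def conj_rep_mult)

section \<open>Rotations as conjugations by quaternions\<close>

lemma mink_qturn: "mink (qturn p t) w = - det (vector [p, t, w] :: real^3^3)"
  by (simp add: mink_def qturn_def pure_part_def pure_def times_quat_def det_3 algebra_simps)

text \<open>By \<open>mink_qturn\<close>, \<open>qturn\<close> is up to sign the cross product dual
  to the determinant. Determinant and form are both invariant, and the form is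
  nondegenerate.\<close>

lemma qturn_SO12:
  assumes "A \<in> SO12"
  shows "qturn (A *v p) (A *v t) = A *v qturn p t"
proof (rule mink_nondegenerate)
  fix w
  obtain B where B: "A ** B = mat 1" using SO12_inverse[OF assms] .
  have w: "A *v (B *v w) = w" by (simp add: matrix_vector_mul_assoc B)
  have "mink (qturn (A *v p) (A *v t)) (A *v (B *v w)) = mink (A *v qturn p t) (A *v (B *v w))"
    using assms by (simp only: mink_qturn det_vector_transform mink_SO12) (simp add: SO12_def)
  then show "mink (qturn (A *v p) (A *v t)) w = mink (A *v qturn p t) w"
    by (simp only: w)
qed

lemma tang_SO12:
  assumes "A \<in> SO12"
  shows "tang (A *v p) (A *v t) = A *v tang p t"
  using assms by (simp add: tang_def mink_SO12 matrix_vector_mult_diff_distrib matrix_vector_mult_scaleR)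

lemma hrot_SO12:
  assumes "A \<in> SO12" "v \<in> H2" "A *v v \<in> H2"
  shows "hrot (A *v p) \<theta> (A *v v) = A *v hrot p \<theta> v"
  using assms
  by (simp add: hrot_def mink_SO12 tang_SO12 qturn_SO12 matrix_vector_right_distrib matrix_vector_mult_scaleR)

text \<open>For \<open>p\<close> in \<open>H2\<close> the quaternion \<open>pure p\<close> squares
  to -1, so this is the exponential of \<open>\<theta> / 2\<close> times
  \<open>pure p\<close>.\<close>

definition rot_quat :: "real \<Rightarrow> real^3 \<Rightarrow> quat"
  where "rot_quat \<theta> p = of_real (cos (\<theta> / 2)) + sin (\<theta> / 2) *\<^sub>R pure p"

lemma rot_quat_eq: "rot_quat \<theta> p =
    Quat (cos (\<theta> / 2)) (sin (\<theta> / 2) * p$1) (sin (\<theta> / 2) * p$2) (sin (\<theta> / 2) * p$3)"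
  by (simp add: rot_quat_def pure_def of_real_def plus_quat_def scaleR_quat_def one_quat_def)

lemma qnorm_rot_quat:
  assumes "p \<in> H2"
  shows "qnorm (rot_quat \<theta> p) = 1"
proof -
  have "qnorm (rot_quat \<theta> p) = (cos (\<theta> / 2))\<^sup>2 + (sin (\<theta> / 2))\<^sup>2 * mink p p"
    by (simp add: rot_quat_eq qnorm_eq mink_def power2_eq_square algebra_simps)
  then show ?thesis using assms by (simp add: H2_def)
qed

text \<open>The quaternion acts from both sides, which doubles the half angle. After the
  double-angle formulas each coordinate is a polynomial identity modulo \<open>cs\<close> and
  \<open>p\<close>.\<close>

lemma conj_rep_rot_quat:
  assumes "p \<in> H2" "v \<in> H2"
  shows "conj_rep (rot_quat \<theta> p) *v v = hrot p \<theta> v"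
proof -
  define c s where "c = cos (\<theta> / 2)" and "s = sin (\<theta> / 2)"
  have cs: "c\<^sup>2 + s\<^sup>2 = 1" by (simp add: c_def s_def)
  have \<theta>: "cos \<theta> = c\<^sup>2 - s\<^sup>2" "sin \<theta> = 2 * s * c"
    using cos_double[of "\<theta> / 2"] sin_double[of "\<theta> / 2"] by (simp_all add: c_def s_def)
  have p: "p$1 * p$1 - p$2 * p$2 - p$3 * p$3 = 1"
    using assms by (simp add: H2_def mink_def)
  show ?thesis
    using assms(2)
    apply (simp add: hrot_def \<theta> rot_quat_eq flip: c_def s_def)
    apply (rule vec3_eqI)
    using cs p
    by (simp_all add: conj_rep_entries mat3_mult_vec tang_def qturn_def pure_part_def pure_def times_quat_def mink_def)
      algebra+
qed

section \<open>Transport of rotation groups\<close>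

text \<open>The hyperboloid contains a basis of the whole space.\<close>

lemma matrix_eq_on_H2:
  fixes A B :: "real^3^3"
  assumes "\<And>v. v \<in> H2 \<Longrightarrow> A *v v = B *v v"
  shows "A = B"
proof -
  have mem: "vector [1, 0, 0] \<in> H2" "vector [sqrt 2, 1, 0] \<in> H2" "vector [sqrt 2, 0, 1] \<in> H2"
    by (simp_all add: H2_def mink_def)
  have "A$i$1 = B$i$1" "A$i$2 = B$i$2" "A$i$3 = B$i$3" for i
    using mem[THEN assms, THEN arg_cong[of _ _ "\<lambda>v. v $ i"]]
    by (simp_all add: mat3_mult_vec)
  then show ?thesis by (simp add: vec_eq_iff forall_3)
qed

lemma generate_iso:
  assumes "group_hom G H h" "inj_on h (carrier G)" "K \<subseteq> carrier G"
  shows "G\<lparr>carrier := generate G K\<rparr> \<cong> H\<lparr>carrier := generate H (h ` K)\<rparr>"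
proof -
  interpret group_hom G H h by fact
  have sub: "generate G K \<subseteq> carrier G" by (rule G.generate_incl) fact
  then have "h \<in> hom (G\<lparr>carrier := generate G K\<rparr>) (H\<lparr>carrier := generate H (h ` K)\<rparr>)"
    by (intro homI) (simp_all add: generate_img[OF assms(3)] subset_iff)
  moreover have "inj_on h (generate G K)" using assms(2) sub by (rule inj_on_subset)
  ultimately show ?thesis
    by (intro is_isoI[of h]) (simp add: iso_def bij_betw_def generate_img[OF assms(3)])
qed

text \<open>Conjugation by \<open>g\<close>, where \<open>h\<close> stands for its inverse. The
  restriction makes the result extensional, as \<open>Bij H2\<close> demands.\<close>

definition transport :: "real^3^3 \<Rightarrow> real^3^3 \<Rightarrow> real^3^3 \<Rightarrow> real^3 \<Rightarrow> real^3"
  where "transport g h A = restrict ((*v) (g ** A ** h)) H2"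

text \<open>The inner factors \<open>h ** g\<close> cancel in a product, \<open>H2\<close>
  determines a matrix, and \<open>hrot\<close> is equivariant, so a rotation becomes the rotation
  about the moved centre.\<close>

lemma transport:
  assumes g: "g \<in> SO12" "g *v pole \<in> H2" and h: "h \<in> SO12" "g ** h = mat 1" "h ** g = mat 1"
  shows "group_hom SO0_12 Iso_plus (transport g h)"
    and "inj_on (transport g h) (carrier SO0_12)"
    and "p \<in> H2 \<Longrightarrow> transport g h (conj_rep (rot_quat \<theta> p)) = hrot (g *v p) \<theta>"
proof -
  have hg: "g *v (h *v v) = v" "h *v (g *v v) = v" for v
    by (simp_all add: matrix_vector_mul_assoc h)
  have gH: "g *v v \<in> H2" if "v \<in> H2" for v
    using SO12_H2[OF g(1,2) pole_H2 that] .
  have hH: "h *v v \<in> H2" if "v \<in> H2" for v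
    using SO12_H2[OF h(1), of "g *v pole" v] that g(2) pole_H2 by (simp add: hg)
  have gAh: "g ** A ** h \<in> SO12" "(g ** A ** h) *v v = g *v (A *v (h *v v))"
    "v \<in> H2 \<Longrightarrow> g *v (A *v (h *v v)) \<in> H2"
    if "A \<in> carrier SO0_12" for A v
    using that subsetD[OF SO0_12_subset] g(1) h(1)
    by (auto intro!: SO12_mult gH SO0_12_H2 hH simp flip: matrix_vector_mul_assoc)
  have carrier: "transport g h A \<in> carrier Iso_plus" if "A \<in> carrier SO0_12" for A
    unfolding transport_def using gAh[OF that] by (intro restrict_SO12_Iso_plus) simp_all
  have mult: "transport g h (A ** B) = compose H2 (transport g h A) (transport g h B)"
    if "A \<in> carrier SO0_12" "B \<in> carrier SO0_12" for A B
  proof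
    fix v
    show "transport g h (A ** B) v = compose H2 (transport g h A) (transport g h B) v"
      using gAh(2)[OF that(1)] gAh(3)[OF that(2), of v] gAh(2)[OF that(2), of v]
      by (cases "v \<in> H2")
        (simp_all add: transport_def compose_def hg flip: matrix_vector_mul_assoc)
  qed
  have "transport g h \<in> hom SO0_12 Iso_plus"
  proof (rule homI)
    fix A B assume "A \<in> carrier SO0_12" "B \<in> carrier SO0_12"
    then show "transport g h (A \<otimes>\<^bsub>SO0_12\<^esub> B) = transport g h A \<otimes>\<^bsub>Iso_plus\<^esub> transport g h B"
      using carrier[of A] carrier[of B] mult[of A B]
      by (simp add: SO0_12_def Iso_plus_def BijGroup_def)
  qed (rule carrier)
  then show "group_hom SO0_12 Iso_plus (transport g h)"
    by (intro group_hom.intro group_hom_axioms.intro group_SO0_12 group_Iso_plus)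
  show "inj_on (transport g h) (carrier SO0_12)"
  proof (rule inj_onI)
    fix A B assume eq: "transport g h A = transport g h B"
    have "A *v v = B *v v" if "v \<in> H2" for v
    proof -
      have "transport g h A (g *v v) = transport g h B (g *v v)" by (simp add: eq)
      then have "h *v (g *v (A *v v)) = h *v (g *v (B *v v))"
        using gH[OF that] by (simp add: transport_def hg flip: matrix_vector_mul_assoc)
      then show ?thesis by (simp add: hg)
    qed
    then show "A = B" by (rule matrix_eq_on_H2)
  qed
  show "transport g h (conj_rep (rot_quat \<theta> p)) = hrot (g *v p) \<theta>" if p: "p \<in> H2"
  proof
    fix v
    show "transport g h (conj_rep (rot_quat \<theta> p)) v = hrot (g *v p) \<theta> v"
    proof (cases "v \<in> H2")
      case True
      then have "hrot (g *v p) \<theta> (g *v (h *v v)) = g *v hrot p \<theta> (h *v v)"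
        by (intro hrot_SO12 g hH) (simp_all add: hg)
      with True show ?thesis
        using conj_rep_rot_quat[OF p hH[OF True]]
        by (simp add: transport_def hg flip: matrix_vector_mul_assoc)
    qed (simp add: transport_def hrot_def)
  qed
qed

text \<open>For \<open>1 \<le> c\<close>, the point at distance arcosh \<open>c\<close> from
  \<open>pole\<close> in the direction of \<open>j\<close>.\<close>

definition along :: "real \<Rightarrow> real^3"
  where "along c = vector [c, sqrt (c\<^sup>2 - 1), 0]"

lemma along_H2: "along c \<in> H2" if "1 \<le> c"
proof -
  have "1 \<le> c\<^sup>2" using that by simp
  then show ?thesis using that by (simp add: along_def H2_def mink_def flip: power2_eq_square)
qed

lemma mink_tang:
  assumes "p \<in> H2"
  shows "mink (tang p u) (tang p v) = mink u v - mink p u * mink p v"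
  using assms by (simp add: tang_def mink_diff mink_scaleR H2_def mink_commute[of u p] algebra_simps)

text \<open>\<open>P\<close>, the unit tangent vector at \<open>P\<close> towards \<open>Q\<close>
  and its quarter turn form a positively oriented orthonormal frame; these are the columns of
  \<open>g\<close>.\<close>

lemma obtain_frame:
  assumes "P \<in> H2" "Q \<in> H2" "P \<noteq> Q"
  obtains g where "g \<in> SO12" "g *v pole = P" "g *v along (mink P Q) = Q"
proof -
  \<comment> \<open>The hyperbolic sine of the distance from \<open>P\<close> to \<open>Q\<close>,
    which is the length of \<open>tang P Q\<close>.\<close>
  define k where "k = sqrt ((mink P Q)\<^sup>2 - 1)"
  have "1 < mink P Q" using mink_ge_1[OF assms(1,2)] assms(3) by force
  then have k: "0 < k" "k\<^sup>2 = (mink P Q)\<^sup>2 - 1" by (simp_all add: k_def)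
  define t where "t = (1 / k) *\<^sub>R tang P Q"
  have "mink P (tang P Q) = 0"
    using assms(1) by (simp add: tang_def mink_diff mink_scaleR H2_def)
  then have Pt: "mink P t = 0" by (simp add: t_def mink_scaleR)
  have "mink (tang P Q) (tang P Q) = - (k\<^sup>2)"
    using assms k(2) by (simp add: mink_tang H2_def power2_eq_square)
  then have tt: "mink t t = - 1" using k(1) by (simp add: t_def mink_scaleR power2_eq_square)
  note q = qturn[OF assms(1) Pt]
  define g :: "real^3^3" where "g = transpose (vector [P, t, qturn P t])"
  have gv: "g *v v = v$1 *\<^sub>R P + v$2 *\<^sub>R t + v$3 *\<^sub>R qturn P t" for v
    by (rule vec3_eqI) (simp_all add: mat3_mult_vec g_def transpose_def)
  have comm: "mink t P = 0" "mink (qturn P t) P = 0" "mink (qturn P t) t = 0"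
    using Pt q(2,3) by (simp_all add: mink_commute)
  have "mink (g *v u) (g *v v) = mink u v" for u v
    unfolding gv using q(2-4) Pt comm tt assms(1)
    by (simp add: mink_add mink_scaleR H2_def mink_def[of u v])
  moreover have "det g = 1" using q(5) tt by (simp add: g_def det_transpose)
  ultimately have "g \<in> SO12" by (simp add: SO12_def)
  moreover have "g *v pole = P" by (simp add: gv pole_nth)
  moreover have "g *v along (mink P Q) = Q"
    using k(1) by (simp add: gv along_def t_def tang_def flip: k_def)
  ultimately show ?thesis by (rule that)
qed

text \<open>Only the distance of the two centres matters: a motion takes the standard pair to
  \<open>P\<close>, \<open>Q\<close>, and conjugation by it matches the generators.\<close>

lemma rotation_group_iso_holonomy:
  assumes "P \<in> H2" "Q \<in> H2" "P \<noteq> Q" "mink P Q = c"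
  shows "SO0_12\<lparr>carrier := generate SO0_12 {conj_rep (rot_quat \<alpha> pole), conj_rep (rot_quat \<alpha> (along c))}\<rparr>
    \<cong> cone_holonomy \<alpha> P Q"
proof -
  obtain g where g: "g \<in> SO12" "g *v pole = P" "g *v along c = Q"
    using obtain_frame[OF assms(1-3)] assms(4) by blast
  obtain h where h: "h \<in> SO12" "g ** h = mat 1" "h ** g = mat 1"
    using SO12_inverse[OF g(1)] .
  have c: "along c \<in> H2" using mink_ge_1(1)[OF assms(1,2)] assms(4) by (intro along_H2) simp
  have gP: "g *v pole \<in> H2" using g(2) assms(1) by simp
  note t = transport[OF g(1) gP h]
  show ?thesis
    using generate_iso[OF t(1,2), of "{conj_rep (rot_quat \<alpha> pole), conj_rep (rot_quat \<alpha> (along c))}"]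
    by (simp add: t(3) c pole_H2 g cone_holonomy_def conj_rep_SO0_12 qnorm_rot_quat)
qed

section \<open>The triangle\<close>

lemma hangle_eq:
  assumes "p \<in> H2" "u \<in> H2" "v \<in> H2"
  shows "hangle u p v = arccos ((mink p u * mink p v - mink u v) /
    (sqrt ((mink p u)\<^sup>2 - 1) * sqrt ((mink p v)\<^sup>2 - 1)))"
  using assms(2,3) by (simp add: hangle_def mink_tang[OF assms(1)] power2_eq_square) (simp add: H2_def)

text \<open>The right-hand side is the Gram determinant; the form has diagonal matrix 1, -1, -1 of
  determinant 1, so no sign appears.\<close>

lemma gram_det:
  "(det (vector [u, v, w] :: real^3^3))\<^sup>2 =
    mink u u * mink v v * mink w w + 2 * mink u v * mink u w * mink v w
    - mink u u * (mink v w)\<^sup>2 - mink v v * (mink u w)\<^sup>2 - mink w w * (mink u v)\<^sup>2"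
  by (simp add: det_3 mink_def) algebra

text \<open>Here \<open>mink\<close> is the hyperbolic cosine of a distance and the roots are
  hyperbolic sines. That the argument of \<open>arccos\<close> lies between -1 and 1 follows because
  the Gram determinant is a square.\<close>

lemma hyperbolic_law_of_cosines:
  assumes "p \<in> H2" "u \<in> H2" "v \<in> H2" "u \<noteq> p" "v \<noteq> p"
  shows "mink p u * mink p v - mink u v =
    cos (hangle u p v) * (sqrt ((mink p u)\<^sup>2 - 1) * sqrt ((mink p v)\<^sup>2 - 1))"
proof -
  define a b where "a = mink p u" and "b = mink p v"
  define d where "d = sqrt (a\<^sup>2 - 1) * sqrt (b\<^sup>2 - 1)"
  have "1 < a" "1 < b"
    using mink_ge_1[of p u] mink_ge_1[of p v] assms by (force simp: a_def b_def)+
  then have d: "0 < d" "d\<^sup>2 = (a\<^sup>2 - 1) * (b\<^sup>2 - 1)"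
    by (simp_all add: d_def power_mult_distrib)
  have "0 \<le> (det (vector [p, u, v] :: real^3^3))\<^sup>2" by simp
  also have "\<dots> = d\<^sup>2 - (a * b - mink u v)\<^sup>2"
    using assms(1-3) unfolding gram_det d(2)
    by (simp add: H2_def a_def b_def power2_eq_square algebra_simps)
  finally have "\<bar>a * b - mink u v\<bar> \<le> \<bar>d\<bar>"
    by (simp add: abs_le_square_iff)
  then have "\<bar>(a * b - mink u v) / d\<bar> \<le> 1" using d(1) by simp
  then have "cos (hangle u p v) = (a * b - mink u v) / d"
    using assms by (simp add: hangle_eq cos_arccos_abs flip: a_def b_def d_def)
  then show ?thesis using d(1) by (simp flip: a_def b_def d_def)
qed

text \<open>The law of cosines for angles, in a triangle with two angles of cosine \<open>x\<close>.\<close>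

lemma cone_triangle_mink:
  assumes "cone_triangle \<alpha> P Q R" and x: "x = cos (\<alpha> / 2)" "x\<^sup>2 < 1"
  shows "mink P Q = (2 * x\<^sup>2 - 1) / (2 * (1 - x\<^sup>2))"
proof -
  have H: "P \<in> H2" "Q \<in> H2" "R \<in> H2" and ne: "P \<noteq> Q" "P \<noteq> R" "Q \<noteq> R"
    using assms(1) by (auto simp: cone_triangle_def)
  define a b c where "a = mink Q R" and "b = mink P R" and "c = mink P Q"
  define A B C where "A = sqrt (a\<^sup>2 - 1)" and "B = sqrt (b\<^sup>2 - 1)" and "C = sqrt (c\<^sup>2 - 1)"
  have gt: "1 < a" "1 < b" "1 < c"
    using mink_ge_1[of Q R] mink_ge_1[of P R] mink_ge_1[of P Q] H ne
    by (force simp: a_def b_def c_def)+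
  then have sq: "A\<^sup>2 = a\<^sup>2 - 1" "B\<^sup>2 = b\<^sup>2 - 1" "C\<^sup>2 = c\<^sup>2 - 1" and pos: "0 < A" "0 < B" "0 < C"
    by (simp_all add: A_def B_def C_def)
  have angle: "hangle P R Q = 2 * pi / 3" "hangle R P Q = \<alpha> / 2" "hangle R Q P = \<alpha> / 2"
    using assms(1) by (simp_all add: cone_triangle_def)
  have R: "b * a - c = - (1 / 2) * (B * A)"
    using hyperbolic_law_of_cosines[of R P Q, unfolded angle cos_120] H ne
    by (simp add: mink_commute[of R] flip: a_def b_def c_def A_def B_def)
  have P: "b * c - a = x * (B * C)"
    using hyperbolic_law_of_cosines[of P R Q, unfolded angle, folded x(1)] H ne
    by (simp add: mink_commute[of R Q] flip: a_def b_def c_def C_def B_def)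
  have Q: "a * c - b = x * (A * C)"
    using hyperbolic_law_of_cosines[of Q R P, unfolded angle, folded x(1)] H ne
    by (simp add: mink_commute[of R P] mink_commute[of Q P] flip: a_def b_def c_def A_def C_def)
  \<comment> \<open>Squaring \<open>P\<close> and \<open>Q\<close> shows that both sides equal the
    symmetric Gram expression \<open>1 + 2*a*b*c - a^2 - b^2 - c^2\<close>. Thus the triangle is
    isosceles.\<close>
  have "(1 - x\<^sup>2) * (C\<^sup>2 * A\<^sup>2) = (1 - x\<^sup>2) * (C\<^sup>2 * B\<^sup>2)"
    using P Q sq by algebra
  moreover have "1 - x\<^sup>2 \<noteq> 0" "C\<^sup>2 \<noteq> 0" using x(2) pos by auto
  ultimately have "A\<^sup>2 = B\<^sup>2" by (metis mult_left_cancel)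
  then have "a\<^sup>2 = b\<^sup>2" by (simp add: sq)
  then have ab: "b = a" using gt by (simp add: power2_eq_iff_nonneg)
  then have "B = A" by (simp add: A_def B_def)
  then have "2 * (a * a - c) = - (A * A)" using R ab by simp
  then have c: "2 * c = 3 * a\<^sup>2 - 1" using sq by algebra
  \<comment> \<open>The square of \<open>Q\<close> with \<open>b = a\<close>, where
    \<open>C^2\<close> splits as \<open>(c - 1) * (c + 1)\<close>.\<close>
  have "(c - 1) * (a\<^sup>2 * (c - 1)) = (c - 1) * (x\<^sup>2 * ((a\<^sup>2 - 1) * (c + 1)))"
    using Q sq ab by algebra
  then have "a\<^sup>2 * (c - 1) = x\<^sup>2 * ((a\<^sup>2 - 1) * (c + 1))" using gt by simp
  \<comment> \<open>Substitute \<open>2 * (c - 1) = 3 * (a^2 - 1)\<close> and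
    \<open>2 * (c + 1) = 3 * a^2 + 1\<close>.\<close>
  with c have "(a\<^sup>2 - 1) * (3 * a\<^sup>2) = (a\<^sup>2 - 1) * (x\<^sup>2 * (3 * a\<^sup>2 + 1))" by algebra
  moreover have "a\<^sup>2 - 1 \<noteq> 0" using pos sq by auto
  ultimately have "3 * a\<^sup>2 = x\<^sup>2 * (3 * a\<^sup>2 + 1)" by simp
  with c have "c * (2 * (1 - x\<^sup>2)) = 2 * x\<^sup>2 - 1" by algebra
  then show ?thesis using x(2) by (simp add: eq_divide_eq flip: c_def)
qed

text \<open>The side lengths forced by the angles are realised by explicit vertices;
  \<open>3 / 4 < x\<^sup>2\<close> makes both hyperbolic cosines \<open>c\<close> and
  \<open>a\<close> exceed 1.\<close>

lemma cone_triangle_exists: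
  assumes x: "x = cos (\<alpha> / 2)" "3 / 4 < x\<^sup>2" "0 < x" "x\<^sup>2 < 1" and \<alpha>: "0 < \<alpha>" "\<alpha> < pi"
  shows "\<exists>P Q R. cone_triangle \<alpha> P Q R"
proof -
  define w where "w = 1 - x\<^sup>2"
  define c where "c = (2 * x\<^sup>2 - 1) / (2 * w)"
  define k where "k = sqrt (c\<^sup>2 - 1)"
  \<comment> \<open>The solution of \<open>3 * a^2 = x^2 * (3 * a^2 + 1)\<close>, the equation for
    the equal sides in \<open>cone_triangle_mink\<close>.\<close>
  define a where "a = sqrt (x\<^sup>2 / (3 * w))"
  define A where "A = sqrt (a\<^sup>2 - 1)"
  define s where "s = sin (\<alpha> / 2)"
  have w: "0 < w" using x by (simp add: w_def)
  have xs: "x\<^sup>2 + s\<^sup>2 = 1" by (simp add: x(1) s_def)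
  have aa: "a\<^sup>2 = x\<^sup>2 / (3 * w)" using w by (simp add: a_def)
  have c: "c - 1 = (4 * x\<^sup>2 - 3) / (2 * w)" "c + 1 = 1 / (2 * w)"
    using w by (simp_all add: c_def w_def field_simps)
  have a1: "a\<^sup>2 - 1 = (4 * x\<^sup>2 - 3) / (3 * w)"
    using w by (simp add: aa w_def field_simps)
  have "0 < c - 1" "0 < a\<^sup>2 - 1" unfolding c a1 using x w by simp_all
  moreover have "0 \<le> a" using w by (simp add: a_def)
  ultimately have gt: "1 < c" "1 < a" by (simp_all add: power_gt1_lemma one_less_power) (smt (verit) power_le_one)
  then have sq: "A\<^sup>2 = a\<^sup>2 - 1" "k\<^sup>2 = c\<^sup>2 - 1" and pos: "0 < A" "0 < k"
    by (simp_all add: A_def k_def)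
  have "(a * (c - 1))\<^sup>2 = a\<^sup>2 * (c - 1)\<^sup>2" by (simp add: power_mult_distrib)
  also have "\<dots> = x\<^sup>2 / (3 * w) * ((4 * x\<^sup>2 - 3) / (2 * w))\<^sup>2"
    by (simp only: aa c)
  also have "\<dots> = x\<^sup>2 * ((4 * x\<^sup>2 - 3) / (3 * w) * ((4 * x\<^sup>2 - 3) / (2 * w) * (1 / (2 * w))))"
    by (simp add: power2_eq_square)
  also have "\<dots> = x\<^sup>2 * ((a\<^sup>2 - 1) * ((c - 1) * (c + 1)))"
    by (simp only: a1 c)
  also have "\<dots> = (x * (A * k))\<^sup>2"
    unfolding power_mult_distrib sq by (simp add: power2_eq_square algebra_simps)
  \<comment> \<open>Neither side is negative, so equal squares suffice. This is the law of cosines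
    at \<open>pole\<close>, and it also makes \<open>mink Q R\<close> equal to
    \<open>a\<close>.\<close>
  finally have side: "a * (c - 1) = x * (A * k)"
    using gt pos x by (simp add: power2_eq_iff_nonneg)
  \<comment> \<open>Polar coordinates about \<open>pole\<close>: \<open>R\<close> lies in the
    direction at angle \<open>\<alpha> / 2\<close> from that of \<open>Q\<close>.\<close>
  define Q R where "Q = along c" and "R = (vector [a, x * A, s * A] :: real^3)"
  have Q: "Q \<in> H2" using along_H2 gt by (simp add: Q_def)
  have "a * a - x * A * (x * A) - s * A * (s * A) = 1" using xs sq by algebra
  then have R: "R \<in> H2" using gt by (simp add: R_def H2_def mink_def)
  have PQ: "mink pole Q = c" and PR: "mink pole R = a"
    by (simp_all add: mink_pole Q_def R_def along_def)
  have QR: "mink Q R = a"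
    using side by (simp add: mink_def Q_def R_def along_def algebra_simps flip: k_def)
  have "pole \<noteq> Q" "pole \<noteq> R" "Q \<noteq> R"
    using mink_ge_1(2)[OF pole_H2 Q] mink_ge_1(2)[OF pole_H2 R] mink_ge_1(2)[OF Q R] PQ PR QR gt
    by auto
  moreover have "hangle pole R Q = 2 * pi / 3"
  proof -
    have "(a * a - c) / (A * A) = - (1 / 2)"
    proof -
      have "2 * c = 3 * a\<^sup>2 - 1" using w by (simp add: c_def aa w_def field_simps)
      then have "a * a - c = - (1 / 2) * (A * A)" using sq by algebra
      then show ?thesis using pos by simp
    qed
    then have "hangle pole R Q = arccos (cos (2 * pi / 3))"
      using pole_H2 Q R PQ PR QR
      by (simp add: hangle_eq mink_commute[of R] cos_120 flip: A_def)
    then show ?thesis by (simp add: arccos_cos del: cos_arccos)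
  qed
  moreover have "hangle R pole Q = \<alpha> / 2" "hangle R Q pole = \<alpha> / 2"
  proof -
    have "(a * c - a) / (A * k) = x" using side pos by (simp add: field_simps)
    then have "hangle R pole Q = arccos (cos (\<alpha> / 2))" "hangle R Q pole = arccos (cos (\<alpha> / 2))"
      using pole_H2 Q R PQ PR QR
      by (simp_all add: hangle_eq mink_commute[of R] mink_commute[of Q pole] flip: A_def k_def x(1))
    then show "hangle R pole Q = \<alpha> / 2" "hangle R Q pole = \<alpha> / 2"
      using \<alpha> by (simp_all add: arccos_cos del: cos_arccos)
  qed
  ultimately show ?thesis
    using pole_H2 Q R unfolding cone_triangle_def by (intro exI[of _ pole] exI[of _ Q] exI[of _ R]) simp
qed

section \<open>The trefoil representation\<close>

text \<open>Since \<open>\<alpha> / 2\<close> lies between 0 and a right angle,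
  \<open>sqrt (1 - x\<^sup>2)\<close> is its sine. The value of \<open>c\<close> is the
  \<open>i\<close>-coefficient of the second generator divided by this sine.\<close>

lemma rho_gen_eq:
  assumes x: "x = cos (\<alpha> / 2)" "0 < \<alpha>" "\<alpha> < pi" "3 / 4 < x\<^sup>2" "x\<^sup>2 < 1"
    and c: "c = (2 * x\<^sup>2 - 1) / (2 * (1 - x\<^sup>2))"
  shows "rho_gen x GenA = rot_quat \<alpha> pole" "rho_gen x GenB = rot_quat \<alpha> (along c)"
proof -
  define s where "s = sin (\<alpha> / 2)"
  have s0: "0 < s" using x unfolding s_def by (intro sin_gt_zero) simp_all
  have s2: "s\<^sup>2 = 1 - x\<^sup>2" by (simp add: s_def x(1) sin_squared_eq)
  then have s: "sqrt (1 - x\<^sup>2) = s" using s0 by (metis abs_of_pos real_sqrt_abs)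
  show "rho_gen x GenA = rot_quat \<alpha> pole"
    by (simp add: rho_gen_def s rot_quat_eq of_real_def plus_quat_def scaleR_quat_def one_quat_def
        quat_i_def pole_nth flip: x(1) s_def)
  have sc: "s * c = (2 * x\<^sup>2 - 1) / (2 * s)"
    unfolding c s2[symmetric] using s0 by (simp add: power2_eq_square)
  have "s * sqrt (c\<^sup>2 - 1) = 1 / 2 * sqrt ((4 * x\<^sup>2 - 3) / (1 - x\<^sup>2))"
  proof -
    have "s * sqrt (c\<^sup>2 - 1) = sqrt (s\<^sup>2 * (c\<^sup>2 - 1))" using s0 by (simp add: real_sqrt_mult)
    also have "s\<^sup>2 * (c\<^sup>2 - 1) = (1 / 2)\<^sup>2 * ((4 * x\<^sup>2 - 3) / (1 - x\<^sup>2))"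
    proof -
      \<comment> \<open>Factoring \<open>c^2 - 1\<close> produces the radicand
        \<open>4 * x^2 - 3\<close> of the \<open>j\<close>-coefficient.\<close>
      have "c - 1 = (4 * x\<^sup>2 - 3) / (2 * (1 - x\<^sup>2))" "c + 1 = 1 / (2 * (1 - x\<^sup>2))"
        using x by (simp_all add: c field_simps)
      then have eq: "c\<^sup>2 - 1 = (4 * x\<^sup>2 - 3) / (2 * (1 - x\<^sup>2)) * (1 / (2 * (1 - x\<^sup>2)))"
        by (metis square_diff_one_factored power2_eq_square mult.commute)
      have half: "w * (n / (2 * w) * (1 / (2 * w))) = (1 / 2)\<^sup>2 * (n / w)" if "w \<noteq> 0" for w n :: real
        using that by (simp add: power2_eq_square)
      have "1 - x\<^sup>2 \<noteq> 0" using x(5) by simp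
      then show ?thesis unfolding s2 eq by (rule half)
    qed
    also have "sqrt \<dots> = 1 / 2 * sqrt ((4 * x\<^sup>2 - 3) / (1 - x\<^sup>2))"
      by (simp add: real_sqrt_mult real_sqrt_divide)
    finally show ?thesis .
  qed
  then show "rho_gen x GenB = rot_quat \<alpha> (along c)"
    unfolding rot_quat_eq rho_gen_def gen.case s
    by (simp add: along_def sc of_real_def plus_quat_def scaleR_quat_def one_quat_def
        quat_i_def quat_j_def flip: x(1) s_def)
qed

text \<open>For norm-one quaternions with equal real parts,
  \<open>a*b*a - b*a*b = (2*t - 1) * (a - b)\<close> with \<open>t\<close> the real part of
  \<open>a*b\<close>. The distance encoded in \<open>c\<close> makes \<open>t\<close> equal to
  1/2.\<close>

lemma trefoil_relation:
  assumes x: "x = cos (\<alpha> / 2)" "3 / 4 < x\<^sup>2" "x\<^sup>2 < 1"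
    and c: "c = (2 * x\<^sup>2 - 1) / (2 * (1 - x\<^sup>2))" "1 \<le> c"
  defines "a \<equiv> rot_quat \<alpha> pole" and "b \<equiv> rot_quat \<alpha> (along c)"
  shows "a * (b * a) = b * (a * b)"
proof -
  define s k where "s = sin (\<alpha> / 2)" and "k = sqrt (c\<^sup>2 - 1)"
  have s: "s\<^sup>2 = 1 - x\<^sup>2" by (simp add: s_def x(1) sin_squared_eq)
  have k: "k\<^sup>2 = c\<^sup>2 - 1" using c(2) by (simp add: k_def)
  \<comment> \<open>Equivalent to \<open>x^2 - s^2 * c = 1/2\<close>, the value of the real part of
    \<open>a * b\<close>.\<close>
  have c': "2 * s\<^sup>2 * c = 2 * x\<^sup>2 - 1" using x by (simp add: c s)
  have a: "a = Quat x s 0 0" and b: "b = Quat x (s * c) (s * k) 0"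
    by (simp_all add: a_def b_def rot_quat_eq pole_nth along_def s_def k_def x(1))
  show ?thesis
    using s k c' unfolding a b quat_eq_iff
    by (intro conjI; simp add: times_quat_def; (algebra | simp add: algebra_simps))
qed

text \<open>The existence conjunct keeps the final statement about all triangles from being
  vacuous.\<close>

theorem theorem4:
  fixes x \<alpha> :: real
  assumes "sqrt 3 / 2 < x" and "x < 1"
    and "x = cos (\<alpha> / 2)" and "0 < \<alpha>" and "\<alpha> < 2 * pi / 6"
  shows "rho x \<in> hom trefoil_group U1 \<and>
    rho' x \<in> hom trefoil_group SO0_12 \<and>
    subgroup (rho' x ` carrier trefoil_group) SO0_12 \<and>
    (\<exists>P Q R. cone_triangle \<alpha> P Q R) \<and>
    (\<forall>P Q R. cone_triangle \<alpha> P Q R \<longrightarrow>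
      SO0_12\<lparr>carrier := rho' x ` carrier trefoil_group\<rparr> \<cong> cone_holonomy \<alpha> P Q)"
proof -
  have x0: "0 < x" using assms(1) by (smt (verit) divide_nonneg_pos real_sqrt_ge_zero)
  have "(sqrt 3 / 2)\<^sup>2 < x\<^sup>2" using assms(1) by (intro power_strict_mono) simp_all
  then have x34: "3 / 4 < x\<^sup>2" by (simp add: power_divide)
  have x1: "x\<^sup>2 < 1" using x0 assms(2) by (simp add: abs_square_less_1)
  have \<alpha>: "\<alpha> < pi" using assms(5) pi_gt_zero by linarith
  define c where "c = (2 * x\<^sup>2 - 1) / (2 * (1 - x\<^sup>2))"
  have "1 < c" using x34 x1 by (simp add: c_def less_divide_eq)
  then have c: "1 \<le> c" by simp
  define a b where "a = rot_quat \<alpha> pole" and "b = rot_quat \<alpha> (along c)"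
  have gen: "rho_gen x GenA = a" "rho_gen x GenB = b"
    using rho_gen_eq[OF assms(3,4) \<alpha> x34 x1 c_def] by (simp_all add: a_def b_def)
  have ab: "qnorm a = 1" "qnorm b = 1"
    by (simp_all add: a_def b_def qnorm_rot_quat pole_H2 along_H2 c)
  have U: "rho_gen x g \<in> carrier U1" for g
    using ab by (cases g) (simp_all add: gen U1_def)
  have UNIV_gen: "UNIV = {GenA, GenB}" by (auto intro: gen.exhaust)
  have range: "range (rho_gen x) = {a, b}" by (simp only: UNIV_gen image_insert image_empty gen)
  have rel: "eval_word U1 (rho_gen x) u = eval_word U1 (rho_gen x) v"
    if "(u, v) \<in> {([(GenA, False), (GenB, False), (GenA, False)],
        [(GenB, False), (GenA, False), (GenB, False)])}" for u v
    using that trefoil_relation[OF assms(3) x34 x1 c_def c]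
    by (simp add: gen U1_def a_def b_def)
  have hom: "rho x \<in> hom trefoil_group U1"
    unfolding rho_def trefoil_group_def using group_U1 U rel by (rule pres_lift_hom)
  have hom': "rho' x \<in> hom trefoil_group SO0_12"
    unfolding rho'_def using hom conj_rep_hom by (rule hom_compose)
  have "rho x ` carrier trefoil_group = generate U1 {a, b}"
    unfolding rho_def trefoil_group_def range[symmetric] using group_U1 U rel by (rule pres_lift_image)
  moreover interpret conj_rep: group_hom U1 SO0_12 conj_rep
    by (intro group_hom.intro group_hom_axioms.intro group_U1 group_SO0_12 conj_rep_hom)
  have "conj_rep ` generate U1 {a, b} = generate SO0_12 {conj_rep a, conj_rep b}"
    using conj_rep.generate_img[of "{a, b}"] ab by (simp add: U1_def)
  ultimately have image: "rho' x ` carrier trefoil_group = generate SO0_12 {conj_rep a, conj_rep b}"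
    unfolding rho'_def image_comp[symmetric] by simp
  have "subgroup (rho' x ` carrier trefoil_group) SO0_12"
    unfolding image using ab by (intro conj_rep.H.generate_is_subgroup) (simp add: conj_rep_SO0_12)
  moreover have "\<exists>P Q R. cone_triangle \<alpha> P Q R"
    using cone_triangle_exists[OF assms(3) x34 x0 x1 assms(4) \<alpha>] .
  moreover have "SO0_12\<lparr>carrier := rho' x ` carrier trefoil_group\<rparr> \<cong> cone_holonomy \<alpha> P Q"
    if "cone_triangle \<alpha> P Q R" for P Q R
  proof -
    have "P \<in> H2" "Q \<in> H2" "P \<noteq> Q" using that by (auto simp: cone_triangle_def)
    \<comment> \<open>The distance forced by the cone angles agrees with the one forced by the
      trefoil relation.\<close>
    moreover have "mink P Q = c" unfolding c_def using that assms(3) x1 by (rule cone_triangle_mink)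
    ultimately show ?thesis
      unfolding image a_def b_def by (rule rotation_group_iso_holonomy)
  qed
  ultimately show ?thesis using hom hom' by blast
qed

end
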